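(* Let $\mathcal{T}=(t_{ijkl})\in\widehat{\mathcal{E}}_{4,3}$ and let $(i,j,k)$ be a permutation of $(1,2,3)$ such that $$t_{iiij}t_{ijjj}=0,\qquad -t_{jjjk}t_{jkkk}=t_{iiik}t_{ikkk}=1.$$ Then $\mathcal{T}$ is positive semi-definite if and only if $$t_{1122}=t_{2233}=t_{1133}=t_{iijk}t_{iiij}t_{iiik}=t_{ijkk}t_{ikkk}t_{jkkk}=t_{iiij}t_{iiik}t_{jkkk}=1\quad\text{and}\quad t_{ijjk}=t_{ijjj}=0.$$
   Context: A 4th order 3-dimensional real tensor $\mathcal{T}=(t_{ijkl})_{i,j,k,l\in\{1,2,3\}}$ is symmetric if its entries are invariant under all permutations of the four indices (so, e.g., $t_{ijjk}$ denotes the common value of all entries whose index multiset is $\{i,j,j,k\}$). $\widehat{\mathcal{E}}_{4,3}$ is the set of symmetric 4th order 3-dimensional tensors all of whose entries lie in $\{-1,0,1\}$ and whose diagonal entries satisfy $t_{1111}=t_{2222}=t_{3333}=1$. For $x\in\mathbb{R}^3$ put $\mathcal{T}x^4=\sum_{i,j,k,l=1}^3 t_{ijkl}x_ix_jx_kx_l$. $\mathcal{T}$ is positive semi-definite if $\mathcal{T}x^4\ge 0$ for all $x\in\mathbb{R}^3$. *)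

theory Defs
  imports "HOL-Analysis.Analysis" "HOL-Combinatorics.Permutations"
begin

(* The three index values are the elements 1, 2, 3 of the numeral type 3
   (where the numeral 3 coincides with 0). *)

type_synonym tensor43 = "3 \<Rightarrow> 3 \<Rightarrow> 3 \<Rightarrow> 3 \<Rightarrow> real"

definition symmetric_tensor :: "tensor43 \<Rightarrow> bool" where
  "symmetric_tensor t \<longleftrightarrow>
     (\<forall>\<pi> a. \<pi> permutes {1..4::nat} \<longrightarrow>
        t (a (\<pi> 1)) (a (\<pi> 2)) (a (\<pi> 3)) (a (\<pi> 4)) = t (a 1) (a 2) (a 3) (a 4))"

definition E43_hat :: "tensor43 set" where
  "E43_hat = {t. symmetric_tensor t \<and> (\<forall>i j k l. t i j k l \<in> {-1, 0, 1}) \<and>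
                 t 1 1 1 1 = 1 \<and> t 2 2 2 2 = 1 \<and> t 3 3 3 3 = 1}"

definition tensor_form :: "tensor43 \<Rightarrow> real ^ 3 \<Rightarrow> real" where
  "tensor_form t x =
     (\<Sum>i\<in>UNIV. \<Sum>j\<in>UNIV. \<Sum>k\<in>UNIV. \<Sum>l\<in>UNIV. t i j k l * x $ i * x $ j * x $ k * x $ l)"

definition psd_tensor :: "tensor43 \<Rightarrow> bool" where
  "psd_tensor t \<longleftrightarrow> (\<forall>x. tensor_form t x \<ge> 0)"

end

theory Submission
  imports Defs
begin

text \<open>
  Changing the signs of two of the variables \<open>x = x\<^sub>i\<close>, \<open>y = x\<^sub>j\<close>, \<open>z = x\<^sub>k\<close> reduces to the case
  \<open>t\<^sub>i\<^sub>i\<^sub>i\<^sub>k = t\<^sub>i\<^sub>k\<^sub>k\<^sub>k = t\<^sub>j\<^sub>k\<^sub>k\<^sub>k = 1\<close>, \<open>t\<^sub>j\<^sub>j\<^sub>j\<^sub>k = -1\<close>. For the tensor in the theorem the form is then, with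
  \<open>s = x + z\<close>, the sum of squares
  \<open>(s\<^sup>2 + 2 s y - y\<^sup>2 / 2)\<^sup>2 + 12 y\<^sup>2 (z - s / 2 - y / 6)\<^sup>2 + 5 y\<^sup>4 / 12\<close>.
  Conversely, the restrictions to \<open>y = 0\<close> and to \<open>x = 0\<close> force \<open>t\<^sub>i\<^sub>i\<^sub>k\<^sub>k = t\<^sub>j\<^sub>j\<^sub>k\<^sub>k = 1\<close>; the form then
  vanishes at \<open>(1, 0, -1)\<close>, so its \<open>y\<close>-derivative vanishes there, which gives \<open>t\<^sub>i\<^sub>i\<^sub>i\<^sub>j = 1\<close> and
  \<open>t\<^sub>i\<^sub>i\<^sub>j\<^sub>k = t\<^sub>i\<^sub>j\<^sub>k\<^sub>k\<close>. Evaluation at a few integer points excludes all remaining sign patterns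
  but one.
\<close>

text \<open>The factors 4, 6 and 12 count the arrangements of an index multiset, so the parameters
  are tensor entries.\<close>

definition ternary_quartic ::
  "real \<Rightarrow> real \<Rightarrow> real \<Rightarrow> real \<Rightarrow> real \<Rightarrow> real \<Rightarrow> real \<Rightarrow> real \<Rightarrow> real \<Rightarrow> real \<Rightarrow> real \<Rightarrow> real \<Rightarrow>
   real \<Rightarrow> real \<Rightarrow> real \<Rightarrow> real" where
  "ternary_quartic a b c d e f p q r u v w x y z =
     x^4 + y^4 + z^4
     + 4 * (a * x^3 * y + b * x * y^3 + c * x^3 * z + d * x * z^3 + e * y^3 * z + f * y * z^3)
     + 6 * (p * x^2 * y^2 + q * x^2 * z^2 + r * y^2 * z^2)
     + 12 * (u * x^2 * y * z + v * x * y^2 * z + w * x * y * z^2)"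

lemma ternary_quartic_psd_imp_coeffs:
  assumes psd: "\<And>x y z. ternary_quartic a b 1 1 (-1) 1 p q r u v w x y z \<ge> 0"
    and ab: "a * b = 0"
    and vals: "a \<in> {-1, 0, 1}" "b \<in> {-1, 0, 1}" "p \<in> {-1, 0, 1}" "q \<in> {-1, 0, 1}"
      "r \<in> {-1, 0, 1}" "u \<in> {-1, 0, 1}" "v \<in> {-1, 0, 1}" "w \<in> {-1, 0, 1}"
  shows "a = 1 \<and> b = 0 \<and> p = 1 \<and> q = 1 \<and> r = 1 \<and> u = 1 \<and> v = 0 \<and> w = 1"
proof -
  note form = psd[unfolded ternary_quartic_def]
  \<comment> \<open>The values at these two points are \<open>6 * q - 6\<close> and
    \<open>24 * r - 7\<close>.\<close>
  have q: "q = 1" using form[of 1 0 "-1"] vals(4) by auto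
  have r: "r = 1" using form[of 0 2 1] vals(5) by auto
  \<comment> \<open>On the points \<open>(8, \<plusminus>1, -8)\<close> the term linear in \<open>y\<close> outweighs all others.\<close>
  have bnds: "b \<le> 1" "-1 \<le> b" "p \<le> 1" "-1 \<le> v"
    using vals(2,3,7) by auto
  \<comment> \<open>\<open>4 * X\<close> is the y-derivative at (1, 0, -1), a zero of the
    form.\<close>
  define X where "X = a - 3 * u + 3 * w - 1"
  have "2048 * X + 384 * (p + 1 - 2 * v) + 32 * (b + 1) + 1 \<ge> 0"
    using form[of 8 1 "-8"] q r by (simp add: X_def)
  then have "X > -1" using bnds by (simp add: algebra_simps)
  moreover have "- 2048 * X + 384 * (p + 1 - 2 * v) - 32 * (b + 1) + 1 \<ge> 0"
    using form[of 8 "-1" "-8"] q r by (simp add: X_def)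
  then have "X < 1" using bnds by (simp add: algebra_simps)
  \<comment> \<open>\<open>X\<close> is an integer, hence 0; so \<open>a - 1\<close>, one of -2, -1,
    0, is a multiple of 3.\<close>
  ultimately have a: "a = 1" and uw: "u = w"
    using vals(1,6,8) by (auto simp: X_def)
  have b: "b = 0" using ab a by simp
  have p: "p = 1" using form[of 1 "-1" 0] vals(3) a b by auto
  \<comment> \<open>(-4, 1, 1) gives \<open>3 * u - v\<close> \<ge> 3/2, so \<open>u = 1\<close>.
    Then (-1, 1, 1) gives \<open>9 - 12 * v\<close> \<ge> 0 and (-1, 1, -1) gives
    \<open>1 + 12 * v\<close> \<ge> 0.\<close>
  have "u = 1 \<and> v = 0"
    using form[of 1 1 1] form[of "-2" 1 1] form[of "-1" 1 1] form[of "-4" 1 1]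
      form[of "-3" 1 1] form[of "-1" 1 "-1"] vals(6,7)
    unfolding a b p q r uw[symmetric] by auto
  then show ?thesis using a b p q r uw by simp
qed

lemma ternary_quartic_sum_of_squares:
  "ternary_quartic 1 0 1 1 (-1) 1 1 1 1 1 0 1 x y z =
     ((x + z)^2 + 2 * (x + z) * y - y^2 / 2)^2
     + 12 * (y * (z - (x + z) / 2 - y / 6))^2 + 5 / 12 * (y^2)^2"
  by (simp add: ternary_quartic_def power2_eq_square power3_eq_cube power4_eq_xxxx field_simps)

lemma ternary_quartic_psd_iff:
  assumes "a * b = 0"
    and "a \<in> {-1, 0, 1}" "b \<in> {-1, 0, 1}" "p \<in> {-1, 0, 1}" "q \<in> {-1, 0, 1}"
      "r \<in> {-1, 0, 1}" "u \<in> {-1, 0, 1}" "v \<in> {-1, 0, 1}" "w \<in> {-1, 0, 1}"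
  shows "(\<forall>x y z. ternary_quartic a b 1 1 (-1) 1 p q r u v w x y z \<ge> 0) \<longleftrightarrow>
    a = 1 \<and> b = 0 \<and> p = 1 \<and> q = 1 \<and> r = 1 \<and> u = 1 \<and> v = 0 \<and> w = 1"
    (is "?psd \<longleftrightarrow> ?coeffs")
proof
  assume ?psd
  then show ?coeffs
    by (intro ternary_quartic_psd_imp_coeffs assms) blast
next
  assume ?coeffs
  then show ?psd by (auto simp: ternary_quartic_sum_of_squares)
qed

text \<open>Since \<open>c\<close> and \<open>f\<close> are signs, only odd powers of x and y change
  a coefficient.\<close>

lemma ternary_quartic_flip:
  assumes "c^2 = 1" "f^2 = 1"
  shows "ternary_quartic a b c c (-f) f p q r u v w (c * x) (f * y) z =
    ternary_quartic (a * c * f) (b * c * f) 1 1 (-1) 1 p q r (u * f) (v * c) (w * c * f) x y z"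
  using assms by (auto simp: ternary_quartic_def power2_eq_1_iff algebra_simps)

text \<open>Adjacent transpositions generate all permutations, so as rewrite rules these equations
  sort the indices.\<close>

lemma symmetric_tensor_swap:
  assumes "symmetric_tensor t"
  shows "t a b c d = t b a c d" "t a b c d = t a c b d" "t a b c d = t a b d c"
proof -
  define g :: "nat \<Rightarrow> 3" where "g = (\<lambda>n. if n = 1 then a else if n = 2 then b else if n = 3 then c else d)"
  have swap: "t (g (Transposition.transpose m n 1)) (g (Transposition.transpose m n 2)) (g (Transposition.transpose m n 3)) (g (Transposition.transpose m n 4))
      = t (g 1) (g 2) (g 3) (g 4)"
    if "m \<in> {1..4}" "n \<in> {1..4}" for m n :: nat
    using assms permutes_swap_id[OF that] unfolding symmetric_tensor_def by blast
  show "t a b c d = t b a c d" "t a b c d = t a c b d" "t a b c d = t a b d c"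
    using swap[of 1 2] swap[of 2 3] swap[of 3 4] by (simp_all add: g_def Transposition.transpose_def)
qed

lemma tensor_form_eq_ternary_quartic:
  assumes "symmetric_tensor t" "distinct [i, j, k]"
    and "t i i i i = 1" "t j j j j = 1" "t k k k k = 1"
  shows "tensor_form t x =
    ternary_quartic (t i i i j) (t i j j j) (t i i i k) (t i k k k) (t j j j k) (t j k k k)
      (t i i j j) (t i i k k) (t j j k k) (t i i j k) (t i j j k) (t i j k k)
      (x $ i) (x $ j) (x $ k)"
proof -
  have univ: "(UNIV :: 3 set) = {i, j, k}"
    using assms(2) by (intro card_subset_eq[symmetric]) auto
  have ne: "i \<noteq> j" "i \<noteq> k" "j \<noteq> k" "j \<noteq> i" "k \<noteq> i" "k \<noteq> j"
    using assms(2) by auto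
  have sum3: "(\<Sum>m\<in>UNIV. h m) = h i + h j + h k" for h :: "3 \<Rightarrow> real"
    unfolding univ using ne by simp
  note swap = symmetric_tensor_swap[OF assms(1)]
  have sorted:
    "t i i j i = t i i i j" "t i j i i = t i i i j" "t j i i i = t i i i j"
    "t i i k i = t i i i k" "t i k i i = t i i i k" "t k i i i = t i i i k"
    "t j i j j = t i j j j" "t j j i j = t i j j j" "t j j j i = t i j j j"
    "t j j k j = t j j j k" "t j k j j = t j j j k" "t k j j j = t j j j k"
    "t k i k k = t i k k k" "t k k i k = t i k k k" "t k k k i = t i k k k"
    "t k j k k = t j k k k" "t k k j k = t j k k k" "t k k k j = t j k k k"
    "t i j i j = t i i j j" "t i j j i = t i i j j" "t j i i j = t i i j j"
    "t j i j i = t i i j j" "t j j i i = t i i j j"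
    "t i k i k = t i i k k" "t i k k i = t i i k k" "t k i i k = t i i k k"
    "t k i k i = t i i k k" "t k k i i = t i i k k"
    "t j k j k = t j j k k" "t j k k j = t j j k k" "t k j j k = t j j k k"
    "t k j k j = t j j k k" "t k k j j = t j j k k"
    "t i i k j = t i i j k" "t i j i k = t i i j k" "t i j k i = t i i j k"
    "t i k i j = t i i j k" "t i k j i = t i i j k" "t j i i k = t i i j k"
    "t j i k i = t i i j k" "t j k i i = t i i j k" "t k i i j = t i i j k"
    "t k i j i = t i i j k" "t k j i i = t i i j k"
    "t i j k j = t i j j k" "t i k j j = t i j j k" "t j i j k = t i j j k"
    "t j i k j = t i j j k" "t j j i k = t i j j k" "t j j k i = t i j j k"
    "t j k i j = t i j j k" "t j k j i = t i j j k" "t k i j j = t i j j k"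
    "t k j i j = t i j j k" "t k j j i = t i j j k"
    "t i k j k = t i j k k" "t i k k j = t i j k k" "t j i k k = t i j k k"
    "t j k i k = t i j k k" "t j k k i = t i j k k" "t k i j k = t i j k k"
    "t k i k j = t i j k k" "t k j i k = t i j k k" "t k j k i = t i j k k"
    "t k k i j = t i j k k" "t k k j i = t i j k k"
    by (simp_all add: swap)
  show ?thesis
    unfolding tensor_form_def sum3 ternary_quartic_def sorted assms(3-5)
    by (simp add: power2_eq_square power3_eq_cube power4_eq_xxxx algebra_simps)
qed

theorem theorem3p10:
  fixes t :: tensor43 and i j k :: 3
  assumes "t \<in> E43_hat"
    and "distinct [i, j, k]"
    and "t i i i j * t i j j j = 0"
    and "- (t j j j k * t j k k k) = 1"
    and "t i i i k * t i k k k = 1"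
  shows "psd_tensor t \<longleftrightarrow>
    t 1 1 2 2 = 1 \<and> t 2 2 3 3 = 1 \<and> t 1 1 3 3 = 1 \<and>
    t i i j k * t i i i j * t i i i k = 1 \<and>
    t i j k k * t i k k k * t j k k k = 1 \<and>
    t i i i j * t i i i k * t j k k k = 1 \<and>
    t i j j k = 0 \<and> t i j j j = 0"
proof -
  have sym: "symmetric_tensor t" and vals: "t m n m' n' \<in> {-1, 0, 1}" for m n m' n'
    using assms(1) by (auto simp: E43_hat_def)
  have diag: "t m m m m = 1" for m
    using assms(1) exhaust_3[of m] by (auto simp: E43_hat_def)
  note swap = symmetric_tensor_swap[OF sym]
  have squares: "t i i j j = 1 \<and> t i i k k = 1 \<and> t j j k k = 1 \<longleftrightarrow>
      t 1 1 2 2 = 1 \<and> t 2 2 3 3 = 1 \<and> t 1 1 3 3 = 1"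
  proof -
    have "t n n m m = t m m n n" for m n using swap by metis
    then show ?thesis
      using assms(2) exhaust_3[of i] exhaust_3[of j] exhaust_3[of k] by auto
  qed
  define c f where "c = t i i i k" and "f = t j k k k"
  have c: "c = 1 \<or> c = -1" "t i k k k = c" and f: "f = 1 \<or> f = -1" "t j j j k = -f"
    using vals[of i i i k] vals[of i k k k] vals[of j j j k] vals[of j k k k] assms(4,5)
    by (auto simp: c_def f_def)
  have sign: "r * s \<in> {-1, 0, 1}" if "r \<in> {-1, 0, 1}" "s = 1 \<or> s = -1" for r s :: real
    using that by auto
  have c2: "c^2 = 1" and f2: "f^2 = 1" using c f by (auto simp: power2_eq_1_iff)
  define Q where "Q = ternary_quartic (t i i i j) (t i j j j) c c (-f) f
      (t i i j j) (t i i k k) (t j j k k) (t i i j k) (t i j j k) (t i j k k)"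
  have form: "tensor_form t x = Q (x $ i) (x $ j) (x $ k)" for x
    using tensor_form_eq_ternary_quartic[OF sym assms(2) diag diag diag, of x] c f
    by (simp add: Q_def c_def f_def)
  have "psd_tensor t \<longleftrightarrow> (\<forall>x y z. Q x y z \<ge> 0)"
  proof
    assume psd: "psd_tensor t"
    show "\<forall>x y z. Q x y z \<ge> 0"
    proof (intro allI)
      fix x y z :: real
      define X :: "real ^ 3" where "X = (\<chi> m. if m = i then x else if m = j then y else z)"
      have "X $ i = x" "X $ j = y" "X $ k = z" using assms(2) by (auto simp: X_def)
      with psd form[of X] show "Q x y z \<ge> 0" by (metis psd_tensor_def)
    qed
  qed (simp add: psd_tensor_def form)
  also have "\<dots> \<longleftrightarrow> (\<forall>x y z. Q (c * x) (f * y) z \<ge> 0)"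
  proof (intro iffI allI)
    fix x y z assume "\<forall>x y z. Q (c * x) (f * y) z \<ge> 0"
    \<comment> \<open>The sign change is its own inverse.\<close>
    then have "Q (c * (c * x)) (f * (f * y)) z \<ge> 0" by blast
    then show "Q x y z \<ge> 0" using c f by auto
  qed blast
  also have "\<dots> \<longleftrightarrow> t i i i j * c * f = 1 \<and> t i j j j * c * f = 0 \<and>
      t i i j j = 1 \<and> t i i k k = 1 \<and> t j j k k = 1 \<and>
      t i i j k * f = 1 \<and> t i j j k * c = 0 \<and> t i j k k * c * f = 1"
    unfolding Q_def ternary_quartic_flip[OF c2 f2]
  proof (rule ternary_quartic_psd_iff)
    show "t i i i j * c * f * (t i j j j * c * f) = 0" using assms(3) by auto
  qed (intro sign vals c(1) f(1))+
  \<comment> \<open>From \<open>t i i i j * c * f = 1\<close> follows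
    \<open>t i i i j * c = f\<close>, which turns \<open>t i i j k * f\<close> into the product in
    the statement.\<close>
  finally show ?thesis
    using c f squares by (auto simp flip: c_def f_def)
qed

end
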